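(* A graph $G$ is uniformly $3$-connected if and only if $G$ is $3$-connected and uniformly $3$-edge-connected.
   Context: All graphs are finite, undirected and loopless, but may contain parallel edges. Paths using different parallel edges are different paths. Two or more (distinct) paths are independent if every vertex contained in more than one of the paths is an endpoint of all the paths it is contained in. A graph $G$ is $k$-connected if $|V(G)|\ge k+1$ and $G-S$ is connected for every $S\subseteq V(G)$ with $|S|\le k-1$. A graph $G$ with at least $k+1$ vertices is uniformly $k$-connected if for every pair of distinct vertices of $G$ the maximum number of independent paths between them is exactly $k$. A graph $G$ with at least two vertices is uniformly $k$-edge-connected if for every pair of distinct vertices of $G$ the maximum number of pairwise edge-disjoint paths between them is exactly $k$. *)

theory Defs
  imports Main
begin

text \<open>
  Undirected multigraphs: edges have an identity of their own, and \<open>ends\<close> maps an edge to the set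
  of its endvertices, so parallel edges are distinct edges with equal \<open>ends\<close>.
\<close>

record ('v, 'e) multigraph =
  verts :: "'v set"
  edges :: "'e set"
  ends  :: "'e \<Rightarrow> 'v set"

locale fin_loopless_multigraph =
  fixes G :: "('v, 'e) multigraph"
  assumes finite_verts: "finite (verts G)"
    and finite_edges: "finite (edges G)"
    and ends_subset: "e \<in> edges G \<Longrightarrow> ends G e \<subseteq> verts G"
    and card_ends: "e \<in> edges G \<Longrightarrow> card (ends G e) = 2"

text \<open>
  A path is a sequence of distinct vertices together with the sequence of edges traversed; since the
  edges are recorded, paths using different parallel edges are different.
\<close>

type_synonym ('v, 'e) path = "'v list \<times> 'e list"

definition path_verts :: "('v, 'e) path \<Rightarrow> 'v set" where
  "path_verts p = set (fst p)"

definition path_edges :: "('v, 'e) path \<Rightarrow> 'e set" where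
  "path_edges p = set (snd p)"

definition path_ends :: "('v, 'e) path \<Rightarrow> 'v set" where
  "path_ends p = {hd (fst p), last (fst p)}"

definition is_path :: "('v, 'e) multigraph \<Rightarrow> ('v, 'e) path \<Rightarrow> bool" where
  "is_path G p \<longleftrightarrow>
     length (fst p) = length (snd p) + 1 \<and> distinct (fst p) \<and>
     path_verts p \<subseteq> verts G \<and> path_edges p \<subseteq> edges G \<and>
     (\<forall>i < length (snd p). ends G (snd p ! i) = {fst p ! i, fst p ! (i + 1)})"

definition paths_between :: "('v, 'e) multigraph \<Rightarrow> 'v \<Rightarrow> 'v \<Rightarrow> ('v, 'e) path set" where
  "paths_between G u v = {p. is_path G p \<and> hd (fst p) = u \<and> last (fst p) = v}"

definition independent_paths :: "('v, 'e) path set \<Rightarrow> bool" where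
  "independent_paths P \<longleftrightarrow>
     (\<forall>x. (\<exists>p\<in>P. \<exists>q\<in>P. p \<noteq> q \<and> x \<in> path_verts p \<and> x \<in> path_verts q) \<longrightarrow>
          (\<forall>p\<in>P. x \<in> path_verts p \<longrightarrow> x \<in> path_ends p))"

definition edge_disjoint_paths :: "('v, 'e) path set \<Rightarrow> bool" where
  "edge_disjoint_paths P \<longleftrightarrow>
     (\<forall>p\<in>P. \<forall>q\<in>P. p \<noteq> q \<longrightarrow> path_edges p \<inter> path_edges q = {})"

definition max_independent_paths :: "('v, 'e) multigraph \<Rightarrow> 'v \<Rightarrow> 'v \<Rightarrow> nat" where
  "max_independent_paths G u v =
     Max {card P | P. P \<subseteq> paths_between G u v \<and> independent_paths P}"

definition max_edge_disjoint_paths :: "('v, 'e) multigraph \<Rightarrow> 'v \<Rightarrow> 'v \<Rightarrow> nat" where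
  "max_edge_disjoint_paths G u v =
     Max {card P | P. P \<subseteq> paths_between G u v \<and> edge_disjoint_paths P}"

definition delete_verts :: "('v, 'e) multigraph \<Rightarrow> 'v set \<Rightarrow> ('v, 'e) multigraph" where
  "delete_verts G S =
     G\<lparr>verts := verts G - S, edges := {e \<in> edges G. ends G e \<inter> S = {}}\<rparr>"

definition connected_graph :: "('v, 'e) multigraph \<Rightarrow> bool" where
  "connected_graph G \<longleftrightarrow>
     verts G \<noteq> {} \<and> (\<forall>u\<in>verts G. \<forall>v\<in>verts G. paths_between G u v \<noteq> {})"

text \<open>
  The condition \<open>card S < k\<close> expresses that \<open>S\<close> has at most \<open>k - 1\<close> elements without
  truncated subtraction.
\<close>

definition k_connected :: "nat \<Rightarrow> ('v, 'e) multigraph \<Rightarrow> bool" where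
  "k_connected k G \<longleftrightarrow>
     card (verts G) \<ge> k + 1 \<and>
     (\<forall>S \<subseteq> verts G. card S < k \<longrightarrow> connected_graph (delete_verts G S))"

definition uniformly_k_connected :: "nat \<Rightarrow> ('v, 'e) multigraph \<Rightarrow> bool" where
  "uniformly_k_connected k G \<longleftrightarrow>
     card (verts G) \<ge> k + 1 \<and>
     (\<forall>u\<in>verts G. \<forall>v\<in>verts G. u \<noteq> v \<longrightarrow> max_independent_paths G u v = k)"

definition uniformly_k_edge_connected :: "nat \<Rightarrow> ('v, 'e) multigraph \<Rightarrow> bool" where
  "uniformly_k_edge_connected k G \<longleftrightarrow>
     card (verts G) \<ge> 2 \<and>
     (\<forall>u\<in>verts G. \<forall>v\<in>verts G. u \<noteq> v \<longrightarrow> max_edge_disjoint_paths G u v = k)"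

text \<open>The maxima above range over finite nonempty sets, so \<open>Max\<close> is meaningful.\<close>

context fin_loopless_multigraph
begin

lemma finite_paths_between: "finite (paths_between G u v)"
proof (rule finite_subset)
  let ?A = "{xs. set xs \<subseteq> verts G \<and> length xs \<le> card (verts G)}"
  let ?B = "{es. set es \<subseteq> edges G \<and> length es \<le> card (verts G)}"
  show "paths_between G u v \<subseteq> ?A \<times> ?B"
  proof
    fix p assume p: "p \<in> paths_between G u v"
    then have "length (fst p) = card (set (fst p))" "set (fst p) \<subseteq> verts G"
      by (simp_all add: paths_between_def is_path_def path_verts_def distinct_card)
    then have "length (fst p) \<le> card (verts G)"
      using finite_verts by (simp add: card_mono)
    with p show "p \<in> ?A \<times> ?B"
      by (cases p) (auto simp: paths_between_def is_path_def path_verts_def path_edges_def)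
  qed
  show "finite (?A \<times> ?B)"
    by (intro finite_cartesian_product finite_lists_length_le finite_verts finite_edges)
qed

lemma finite_cards_paths: "finite {card P | P. P \<subseteq> paths_between G u v \<and> Q P}"
  by (rule finite_subset[of _ "card ` Pow (paths_between G u v)"])
    (auto simp: finite_paths_between)

lemma max_independent_paths_eq_iff:
  "max_independent_paths G u v = k \<longleftrightarrow>
     (\<exists>P \<subseteq> paths_between G u v. independent_paths P \<and> card P = k) \<and>
     (\<forall>P \<subseteq> paths_between G u v. independent_paths P \<longrightarrow> card P \<le> k)"
proof -
  have "{card P | P. P \<subseteq> paths_between G u v \<and> independent_paths P} \<noteq> {}"
    by (auto simp: independent_paths_def intro: exI[of _ "{}"])
  then show ?thesis
    unfolding max_independent_paths_def by (subst Max_eq_iff[OF finite_cards_paths]) auto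
qed

lemma max_edge_disjoint_paths_eq_iff:
  "max_edge_disjoint_paths G u v = k \<longleftrightarrow>
     (\<exists>P \<subseteq> paths_between G u v. edge_disjoint_paths P \<and> card P = k) \<and>
     (\<forall>P \<subseteq> paths_between G u v. edge_disjoint_paths P \<longrightarrow> card P \<le> k)"
proof -
  have "{card P | P. P \<subseteq> paths_between G u v \<and> edge_disjoint_paths P} \<noteq> {}"
    by (auto simp: edge_disjoint_paths_def intro: exI[of _ "{}"])
  then show ?thesis
    unfolding max_edge_disjoint_paths_def by (subst Max_eq_iff[OF finite_cards_paths]) auto
qed

end

end

theory Submission
  imports Defs
begin

text \<open>
  Menger's theorem for separators mixing vertices and edges turns both connectivity notions into
  statements about pairs of disjoint vertex sets \<open>(A, B)\<close>, the order of such a separation being the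
  number of vertices outside \<open>A \<union> B\<close> plus the number of edges between \<open>A\<close> and \<open>B\<close>; in a
  3-connected graph all orders are at least 3. Independent paths are edge-disjoint, so the one hard
  point is that a uniformly 3-connected graph has no four edge-disjoint paths between distinct
  vertices \<open>u\<close> and \<open>v\<close>.

  Suppose it has. Choose a separation \<open>(A, B)\<close> of order 3 with \<open>u \<in> A\<close> and \<open>v \<in> B\<close>, with \<open>A\<close>
  smallest and then \<open>B\<close> largest. At least four edges leave \<open>B\<close>, so some vertex \<open>s\<close> outside
  \<open>A \<union> B\<close> has two edges into \<open>B\<close>. Let \<open>(A', B')\<close> be a separation of order 3 with \<open>u \<in> A'\<close>
  and \<open>s \<in> B'\<close>. The choice of \<open>(A, B)\<close> gives \<open>(A \<inter> A', B \<union> B')\<close> order at least 4. The order is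
  submodular, even with the number of edges from \<open>s\<close> to \<open>A' \<inter> B\<close> to spare, so
  \<open>(A \<union> A', B \<inter> B')\<close> has order at most 2. Hence \<open>B \<inter> B'\<close> is empty, and since there are no
  parallel edges, each of the two edges from \<open>s\<close> into \<open>B\<close> either ends in \<open>A' \<inter> B\<close> or accounts for
  a vertex of \<open>B - A'\<close>. Together with \<open>s\<close> itself this adds up to more than the available 6.
\<close>

section \<open>Menger's theorem for directed graphs\<close>

fun walk :: "('a \<times> 'a) set \<Rightarrow> 'a list \<Rightarrow> bool" where
  "walk R [] \<longleftrightarrow> False"
| "walk R [x] \<longleftrightarrow> True"
| "walk R (x # y # xs) \<longleftrightarrow> (x, y) \<in> R \<and> walk R (y # xs)"

text \<open>\<open>T\<close> may meet \<open>A\<close> and \<open>B\<close>; one-element walks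
  count, so \<open>T\<close> must contain \<open>A \<inter> B\<close>.\<close>

definition separates :: "('a \<times> 'a) set \<Rightarrow> 'a set \<Rightarrow> 'a set \<Rightarrow> 'a set \<Rightarrow> bool" where
  "separates R A B T \<longleftrightarrow> (\<forall>p. walk R p \<and> hd p \<in> A \<and> last p \<in> B \<longrightarrow> set p \<inter> T \<noteq> {})"

definition linkage :: "('a \<times> 'a) set \<Rightarrow> 'a set \<Rightarrow> 'a set \<Rightarrow> 'a list set \<Rightarrow> bool" where
  "linkage R A B P \<longleftrightarrow>
     (\<forall>p\<in>P. walk R p \<and> distinct p \<and> hd p \<in> A \<and> last p \<in> B) \<and>
     (\<forall>p\<in>P. \<forall>q\<in>P. p \<noteq> q \<longrightarrow> set p \<inter> set q = {})"

lemma walk_nonempty: "walk R p \<Longrightarrow> p \<noteq> []"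
  by auto

lemma walk_Cons: "walk R (x # xs) \<longleftrightarrow> xs = [] \<or> (x, hd xs) \<in> R \<and> walk R xs"
  by (cases xs) auto

lemma walk_append:
  "walk R (xs @ ys) \<longleftrightarrow>
     (if xs = [] then walk R ys else if ys = [] then walk R xs
      else walk R xs \<and> walk R ys \<and> (last xs, hd ys) \<in> R)"
  by (induction xs) (auto simp: walk_Cons hd_append)

lemma walk_rev: "walk R (rev p) \<longleftrightarrow> walk (R\<inverse>) p"
  by (induction p) (auto simp: walk_append walk_Cons last_rev)

lemma walk_mono: "walk R p \<Longrightarrow> R \<subseteq> R' \<Longrightarrow> walk R' p"
  by (induction p rule: induct_list012) auto

lemma linkage_mono: "linkage R A B P \<Longrightarrow> R \<subseteq> R' \<Longrightarrow> linkage R' A B P"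
  unfolding linkage_def by (auto simp: walk_mono)

text \<open>The arc \<open>(x, y)\<close> is used only at an occurrence of \<open>x\<close> that has
  a successor.\<close>

lemma walk_minus: "walk R p \<Longrightarrow> x \<notin> set (butlast p) \<Longrightarrow> walk (R - {(x, y)}) p"
  by (induction p rule: induct_list012) auto

lemma walk_until_first:
  assumes "walk R p" "set p \<inter> X \<noteq> {}" "x \<in> X"
  obtains q where "walk (R - {(x, y)}) q" "hd q = hd p" "last q \<in> X" "set q \<subseteq> set p"
proof -
  from assms(2) obtain ys z zs where p: "p = ys @ z # zs" "z \<in> X" "\<forall>w\<in>set ys. w \<notin> X"
    using split_list_first_prop[of p "\<lambda>w. w \<in> X"] by blast
  have w: "walk R (ys @ [z])"
    using assms(1) p(1) by (auto simp: walk_append)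
  have "walk (R - {(x, y)}) (ys @ [z])"
    using w p(3) assms(3) by (intro walk_minus) auto
  with p show ?thesis by (intro that[of "ys @ [z]"]) (auto simp: hd_append)
qed

lemma walk_from_last:
  assumes "walk R p" "set p \<inter> Y \<noteq> {}" "y \<in> Y"
  obtains q where "walk (R - {(x, y)}) q" "last q = last p" "hd q \<in> Y" "set q \<subseteq> set p"
proof -
  have "walk (R\<inverse>) (rev p)" using assms(1) by (simp add: walk_rev)
  then obtain q where q: "walk (R\<inverse> - {(y, x)}) q" "hd q = hd (rev p)" "last q \<in> Y"
    "set q \<subseteq> set (rev p)"
    using walk_until_first[of "R\<inverse>" "rev p" Y y x] assms
    by (metis (no_types, lifting) set_rev)
  have "(R\<inverse> - {(y, x)}) = (R - {(x, y)})\<inverse>" by auto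
  with q(1) have "walk (R - {(x, y)}) (rev q)" by (simp add: walk_rev)
  with q show ?thesis by (intro that[of "rev q"]) (auto simp: hd_rev last_rev)
qed

lemma walk_minus_vertex: "walk R p \<Longrightarrow> x \<notin> set p \<or> y \<notin> set p \<Longrightarrow> walk (R - {(x, y)}) p"
  by (induction p rule: induct_list012) auto

text \<open>A walk that misses an end \<open>z\<close> of the arc cannot use the arc, so it survives
  the deletion and meets \<open>S\<close>.\<close>

lemma separates_insert:
  assumes "separates (R - {(x, y)}) A B S" "z = x \<or> z = y"
  shows "separates R A B (insert z S)"
  unfolding separates_def
proof (intro allI impI)
  fix p assume p: "walk R p \<and> hd p \<in> A \<and> last p \<in> B"
  show "set p \<inter> insert z S \<noteq> {}"
  proof (cases "z \<in> set p")
    case False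
    have "walk (R - {(x, y)}) p"
      using p False assms(2) by (intro walk_minus_vertex) auto
    with p assms(1) show ?thesis unfolding separates_def by blast
  qed auto
qed

text \<open>Disjoint walks have distinct ends, so by counting the ends exhaust \<open>X\<close>. A
  walk visiting \<open>X\<close> elsewhere would share a vertex with the walk ending there.\<close>

lemma linkage_covers_end:
  assumes "linkage R A X P" "finite P" "card P = card X" "finite X"
  shows "bij_betw last P X" "\<And>p z. p \<in> P \<Longrightarrow> z \<in> set p \<Longrightarrow> z \<in> X \<Longrightarrow> z = last p"
proof -
  have inj: "inj_on last P"
  proof (rule inj_onI, rule ccontr)
    fix p q assume h: "p \<in> P" "q \<in> P" "last p = last q" "p \<noteq> q"
    then have "set p \<inter> set q = {}" "walk R p" "walk R q"
      using assms(1) unfolding linkage_def by blast+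
    then have "last p \<in> set p" "last q \<in> set q" "set p \<inter> set q = {}"
      by (auto simp: walk_nonempty)
    with h show False by auto
  qed
  have "last ` P \<subseteq> X" using assms(1) unfolding linkage_def by auto
  then have "last ` P = X"
    using card_image[OF inj] assms by (intro card_subset_eq) auto
  with inj show bij: "bij_betw last P X" by (simp add: bij_betw_def)
  fix p z assume z: "p \<in> P" "z \<in> set p" "z \<in> X"
  then obtain q where q: "q \<in> P" "last q = z" using \<open>last ` P = X\<close> by auto
  have "q \<noteq> []" using q assms(1) unfolding linkage_def by auto
  then have "z \<in> set q" using q by auto
  then have "q = p" using z q(1) assms(1) unfolding linkage_def by (meson disjoint_iff)
  then show "z = last p" using q by simp
qed

lemma linkage_rev: "linkage (R\<inverse>) B A (rev ` P)" if "linkage R A B P"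
  using that unfolding linkage_def
  by (auto simp: hd_rev last_rev walk_rev)

lemma linkage_covers_start:
  assumes "linkage R Y B P" "finite P" "card P = card Y" "finite Y"
  shows "bij_betw hd P Y" "\<And>p z. p \<in> P \<Longrightarrow> z \<in> set p \<Longrightarrow> z \<in> Y \<Longrightarrow> z = hd p"
proof -
  have l: "linkage (R\<inverse>) B Y (rev ` P)" using assms(1) by (rule linkage_rev)
  have c: "card (rev ` P) = card Y" using assms(3) by (simp add: card_image)
  note L = linkage_covers_end[OF l _ c assms(4)]
  have "bij_betw (last \<circ> rev) P Y"
    using L(1) assms(2) by (intro bij_betw_trans[of rev P "rev ` P"]) (auto simp: bij_betw_def)
  then show "bij_betw hd P Y" by (rule bij_betw_cong[THEN iffD1, rotated]) (use assms(1) in \<open>auto simp: linkage_def last_rev\<close>)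
  fix p z assume "p \<in> P" "z \<in> set p" "z \<in> Y"
  then show "z = hd p" using L(2)[of "rev p" z] assms(2) by (auto simp: last_rev)
qed

text \<open>
  Goering's proof: if deleting an arc \<open>(x, y)\<close> admits a separator \<open>S\<close> with fewer than \<open>k\<close>
  elements, then \<open>insert x S\<close> and \<open>insert y S\<close> separate in the whole graph, and linkages into the
  first and out of the second, obtained by induction, meet only in \<open>S\<close> and are joined by the arc.
\<close>

theorem menger:
  assumes "finite R" "irrefl R" "finite A"
    and "\<And>T. finite T \<Longrightarrow> separates R A B T \<Longrightarrow> k \<le> card T"
  shows "\<exists>P. linkage R A B P \<and> finite P \<and> card P = k"
  using assms
proof (induction "card R" arbitrary: R A B rule: less_induct)
  case less
  show ?case
  proof (cases "R = {}")
    case True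
    \<comment> \<open>Without arcs every walk is a single vertex.\<close>
    have "separates R A B (A \<inter> B)"
      unfolding separates_def
    proof (intro allI impI)
      fix p assume p: "walk R p \<and> hd p \<in> A \<and> last p \<in> B"
      with True have "tl p = []" by (cases p rule: remdups_adj.cases) auto
      with p show "set p \<inter> (A \<inter> B) \<noteq> {}" by (cases p) auto
    qed
    then have "k \<le> card (A \<inter> B)" using less.prems by auto
    then obtain C where C: "C \<subseteq> A \<inter> B" "card C = k" "finite C"
      by (rule obtain_subset_with_card_n)
    then have "linkage R A B ((\<lambda>c. [c]) ` C)" unfolding linkage_def by auto
    moreover have "card ((\<lambda>c. [c]) ` C) = k" using C by (simp add: card_image inj_on_def)
    ultimately show ?thesis using C by blast
  next
    case False
    then obtain x y where xy: "(x, y) \<in> R" by auto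
    define R' where "R' = R - {(x, y)}"
    have R': "card R' < card R" "finite R'" "irrefl R'" "R' \<subseteq> R"
      using card_Diff1_less[OF less.prems(1) xy] less.prems unfolding R'_def irrefl_def by auto
    show ?thesis
    proof (cases "\<forall>T. finite T \<longrightarrow> separates R' A B T \<longrightarrow> k \<le> card T")
      case True
      then obtain P where "linkage R' A B P" "finite P" "card P = k"
        using less.hyps[OF R'(1-3) less.prems(3)] by blast
      then show ?thesis using linkage_mono R'(4) by blast
    next
      case False
      then obtain S where S: "finite S" "separates R' A B S" "card S < k" by auto
      define X where "X = insert x S"
      define Y where "Y = insert y S"
      have sX: "separates R A B X" and sY: "separates R A B Y"
        using separates_insert S(2) unfolding R'_def X_def Y_def by metis+
      \<comment> \<open>Both sets separate and so have at least \<open>k\<close> elements; as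
        \<open>S\<close> has fewer, they have exactly \<open>k\<close>, and \<open>x\<close>,
        \<open>y\<close> lie outside \<open>S\<close>.\<close>
      have XY: "k = card X" "k = card Y" "x \<notin> S" "y \<notin> S" "finite X" "finite Y"
        using less.prems(4)[OF _ sX] less.prems(4)[OF _ sY] S(1,3)
        by (auto simp: X_def Y_def card_insert_if split: if_splits)
      have "\<exists>P. linkage R' A X P \<and> finite P \<and> card P = k"
      proof (rule less.hyps[OF R'(1-3) less.prems(3)])
        fix T assume T: "finite T" "separates R' A X T"
        \<comment> \<open>Every walk from \<open>A\<close> to \<open>B\<close> reaches
          \<open>X\<close>, and its part up to the first visit to \<open>X\<close> lies in
          \<open>R'\<close>, hence meets \<open>T\<close>.\<close>
        have "separates R A B T"
          unfolding separates_def
        proof (intro allI impI)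
          fix p assume p: "walk R p \<and> hd p \<in> A \<and> last p \<in> B"
          then have "set p \<inter> X \<noteq> {}" using sX unfolding separates_def by blast
          then obtain q where "walk R' q" "hd q = hd p" "last q \<in> X" "set q \<subseteq> set p"
            using walk_until_first[of R p X x y] p unfolding R'_def X_def by auto
          then show "set p \<inter> T \<noteq> {}" using T(2) p unfolding separates_def by fastforce
        qed
        then show "k \<le> card T" using T less.prems by blast
      qed
      then obtain P where P: "linkage R' A X P" "finite P" "card P = card X" using XY by auto
      have "\<exists>P. linkage R' Y B P \<and> finite P \<and> card P = k"
      proof (rule less.hyps[OF R'(1-3) XY(6)])
        fix T assume T: "finite T" "separates R' Y B T"
        have "separates R A B T"
          unfolding separates_def
        proof (intro allI impI)
          fix p assume p: "walk R p \<and> hd p \<in> A \<and> last p \<in> B"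
          then have "set p \<inter> Y \<noteq> {}" using sY unfolding separates_def by blast
          then obtain q where "walk R' q" "last q = last p" "hd q \<in> Y" "set q \<subseteq> set p"
            using walk_from_last[of R p Y y x] p unfolding R'_def Y_def by auto
          then show "set p \<inter> T \<noteq> {}" using T(2) p unfolding separates_def by fastforce
        qed
        then show "k \<le> card T" using T less.prems by blast
      qed
      then obtain Q where Q: "linkage R' Y B Q" "finite Q" "card Q = card Y" using XY by auto
      note cP = linkage_covers_end[OF P XY(5)] and cQ = linkage_covers_start[OF Q XY(6)]
      define p where "p z = inv_into P last z" for z
      define q where "q z = inv_into Q hd z" for z
      have p: "p z \<in> P" "last (p z) = z" if "z \<in> X" for z
        using that cP(1) unfolding p_def bij_betw_def
        by (auto simp: inv_into_into f_inv_into_f)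
      have q: "q z \<in> Q" "hd (q z) = z" if "z \<in> Y" for z
        using that cQ(1) unfolding q_def bij_betw_def
        by (auto simp: inv_into_into f_inv_into_f)
      have pw: "walk R' (p z)" "distinct (p z)" "hd (p z) \<in> A" if "z \<in> X" for z
        using p[OF that] P(1) unfolding linkage_def by auto
      have qw: "walk R' (q z)" "distinct (q z)" "last (q z) \<in> B" if "z \<in> Y" for z
        using q[OF that] Q(1) unfolding linkage_def by auto
      have pd: "set (p z) \<inter> set (p w) = {}" if "z \<in> X" "w \<in> X" "z \<noteq> w" for z w
        using p[OF that(1)] p[OF that(2)] that(3) P(1) unfolding linkage_def by metis
      have qd: "set (q z) \<inter> set (q w) = {}" if "z \<in> Y" "w \<in> Y" "z \<noteq> w" for z w
        using q[OF that(1)] q[OF that(2)] that(3) Q(1) unfolding linkage_def by metis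
      have pX: "c = z" if "z \<in> X" "c \<in> set (p z)" "c \<in> X" for c z
        using cP(2)[of "p z" c] p that by auto
      have qY: "c = z" if "z \<in> Y" "c \<in> set (q z)" "c \<in> Y" for c z
        using cQ(2)[of "q z" c] q that by auto
      \<comment> \<open>Following \<open>p z\<close> to \<open>c\<close> and then \<open>q w\<close>
        gives a walk from \<open>A\<close> to \<open>B\<close> in \<open>R'\<close>, which meets
        \<open>S\<close>. Since \<open>p z\<close> meets \<open>X\<close> only at its end and
        \<open>q w\<close> meets \<open>Y\<close> only at its start, this happens at
        \<open>c\<close>.\<close>
      have meet: "c = z \<and> c = w \<and> c \<in> S"
        if zw: "z \<in> X" "w \<in> Y" "c \<in> set (p z)" "c \<in> set (q w)" for c z w
      proof -
        obtain p1 p2 where ps: "p z = p1 @ c # p2" using zw(3) split_list by metis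
        obtain q1 q2 where qs: "q w = q1 @ c # q2" using zw(4) split_list by metis
        have "walk R' (p1 @ c # q2)"
          using pw(1)[OF zw(1)] qw(1)[OF zw(2)] unfolding ps qs
          by (auto simp: walk_append walk_Cons split: if_splits)
        moreover have "hd (p1 @ c # q2) \<in> A" "last (p1 @ c # q2) \<in> B"
          using pw(3)[OF zw(1)] qw(3)[OF zw(2)] unfolding ps qs
          by (auto simp: hd_append)
        ultimately obtain d where d: "d \<in> set (p1 @ c # q2)" "d \<in> S"
          using S(2) unfolding separates_def by blast
        have dXY: "d \<in> X" "d \<in> Y" using d by (auto simp: X_def Y_def)
        have "c \<in> S"
        proof (cases "d \<in> set (p1 @ [c])")
          case True
          then have "d = last (p z)" using pX[OF zw(1) _ dXY(1)] p[OF zw(1)] ps by auto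
          then have "d = c" using True pw(2)[OF zw(1)] unfolding ps
            by (auto simp: ps split: if_splits)
          then show ?thesis using d by simp
        next
          case False
          then have "d \<in> set q2" using d by auto
          moreover have "d = hd (q w)" using qY[OF zw(2) _ dXY(2)] q[OF zw(2)] qs calculation by auto
          ultimately have False using qw(2)[OF zw(2)] unfolding qs
            by (cases q1) auto
          then show ?thesis ..
        qed
        then show ?thesis using pX[OF zw(1,3)] qY[OF zw(2,4)] by (auto simp: X_def Y_def)
      qed
      \<comment> \<open>The arc \<open>(x, y)\<close> joins the walk into \<open>x\<close> to the
        walk out of \<open>y\<close>. For \<open>z\<close> in \<open>S\<close> the two walks share
        \<open>z\<close>, and \<open>tl\<close> keeps it from appearing twice.\<close>
      define r where "r z = (if z = x then p x @ q y else p z @ tl (q z))" for z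
      have r_set: "set (r z) = set (p z) \<union> set (q (if z = x then y else z))" if "z \<in> X" for z
      proof (cases "z = x")
        case False
        then have z: "z \<in> Y" using that by (auto simp: X_def Y_def)
        have "q z = z # tl (q z)" using q[OF z] qw(1)[OF z] by (cases "q z") auto
        moreover have "z \<in> set (p z)" using p[OF that] pw(1)[OF that] last_in_set walk_nonempty by metis
        ultimately have "set (p z) \<union> set (q z) = set (p z) \<union> set (tl (q z))"
          by (metis (no_types, lifting) insert_absorb Un_insert_left Un_insert_right list.simps(15))
        with False show ?thesis by (simp add: r_def)
      qed (simp add: r_def)
      have mY: "(if z = x then y else z) \<in> Y" if "z \<in> X" for z
        using that by (auto simp: X_def Y_def)
      have x_p: "x \<in> X" and y_q: "y \<in> Y" by (auto simp: X_def Y_def)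
      have r_ok: "walk R (r z) \<and> distinct (r z) \<and> hd (r z) \<in> A \<and> last (r z) \<in> B" if z: "z \<in> X" for z
      proof (cases "z = x")
        case True
        have "walk R (p x)" "walk R (q y)"
          using pw(1)[OF x_p] qw(1)[OF y_q] R'(4) by (auto elim: walk_mono)
        then have "walk R (r z)"
          using True p[OF x_p] q[OF y_q] xy
          unfolding r_def by (simp add: walk_append)
        moreover have "set (p x) \<inter> set (q y) = {}"
          using meet[OF x_p y_q] XY(3) by blast
        ultimately show ?thesis
          using True pw[OF x_p] qw[OF y_q] walk_nonempty[OF pw(1)[OF x_p]] walk_nonempty[OF qw(1)[OF y_q]]
          unfolding r_def by (simp add: hd_append)
      next
        case False
        then have zS: "z \<in> S" "z \<in> Y" using z by (auto simp: X_def Y_def)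
        obtain q' where q': "q z = z # q'" using q[OF zS(2)] qw(1)[OF zS(2)] by (cases "q z") auto
        have w: "walk R (p z)" "walk R (z # q')"
          using pw(1)[OF z] qw(1)[OF zS(2)] R'(4) q' by (auto elim: walk_mono)
        then have "walk R (p z @ q')"
          using p[OF z] by (auto simp: walk_append walk_Cons)
        moreover have "set (p z) \<inter> set q' = {}"
          using meet[OF z zS(2)] qw(2)[OF zS(2)] q' by auto
        moreover have "last (p z @ q') = last (q z)" using q' p[OF z] by auto
        ultimately show ?thesis
          using False pw[OF z] qw[OF zS(2)] q' walk_nonempty[OF pw(1)[OF z]]
          unfolding r_def by (simp add: hd_append)
      qed
      have r_disj: "set (r z) \<inter> set (r w) = {}" if zw: "z \<in> X" "w \<in> X" "z \<noteq> w" for z w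
      proof -
        let ?z = "if z = x then y else z" and ?w = "if w = x then y else w"
        have "?z \<noteq> ?w" using zw XY(4) by (auto simp: X_def)
        then have "set (q ?z) \<inter> set (q ?w) = {}" using qd mY zw(1,2) by blast
        moreover have "set (p z) \<inter> set (p w) = {}" using pd zw by blast
        moreover have "set (p z) \<inter> set (q ?w) = {}"
          using meet[OF zw(1) mY[OF zw(2)]] zw(3) XY(4) unfolding disjoint_iff by metis
        moreover have "set (p w) \<inter> set (q ?z) = {}"
          using meet[OF zw(2) mY[OF zw(1)]] zw(3) XY(4) unfolding disjoint_iff by metis
        ultimately show ?thesis unfolding r_set[OF zw(1)] r_set[OF zw(2)] by blast
      qed
      have "inj_on r X"
      proof (rule inj_onI, rule ccontr)
        fix z w assume h: "z \<in> X" "w \<in> X" "r z = r w" "z \<noteq> w"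
        then have "set (r z) = {}" using r_disj[OF h(1,2,4)] by simp
        then show False using r_ok[OF h(1)] by simp
      qed
      then have "card (r ` X) = k" using XY(1) by (simp add: card_image)
      moreover have "linkage R A B (r ` X)" unfolding linkage_def using r_ok r_disj by blast
      ultimately show ?thesis using XY(5) by blast
    qed
  qed
qed

section \<open>Separations and Menger's theorem for multigraphs\<close>

definition crossing :: "('v, 'e) multigraph \<Rightarrow> 'v set \<Rightarrow> 'v set \<Rightarrow> 'e set" where
  "crossing G A B = {e \<in> edges G. ends G e \<inter> A \<noteq> {} \<and> ends G e \<inter> B \<noteq> {}}"

text \<open>
  \<open>sep_order G A B\<close> is the number of vertices and edges whose removal separates \<open>A\<close> from
  \<open>B\<close>, when \<open>A\<close> and \<open>B\<close> are disjoint: the vertices outside both, and the edges joining them.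
\<close>

definition sep_order :: "('v, 'e) multigraph \<Rightarrow> 'v set \<Rightarrow> 'v set \<Rightarrow> nat" where
  "sep_order G A B = card (verts G - (A \<union> B)) + card (crossing G A B)"

text \<open>
  Edges become vertices, and the vertices in \<open>X\<close> are removed. For \<open>X = {x, y}\<close>, disjoint walks
  from the edges at \<open>x\<close> to the edges at \<open>y\<close> correspond to independent paths from \<open>x\<close> to \<open>y\<close>,
  parallel edges included.
\<close>

definition subdivision :: "('v, 'e) multigraph \<Rightarrow> 'v set \<Rightarrow> (('v + 'e) \<times> ('v + 'e)) set" where
  "subdivision G X =
     {(Inl v, Inr e) | v e. e \<in> edges G \<and> v \<in> ends G e - X} \<union>
     {(Inr e, Inl v) | v e. e \<in> edges G \<and> v \<in> ends G e - X}"

definition lefts :: "('a + 'b) list \<Rightarrow> 'a list" where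
  "lefts p = map projl (filter isl p)"

definition rights :: "('a + 'b) list \<Rightarrow> 'b list" where
  "rights p = map projr (filter (\<lambda>z. \<not> isl z) p)"

lemma lefts_simps [simp]:
  "lefts [] = []" "lefts (Inl v # p) = v # lefts p" "lefts (Inr e # p) = lefts p"
  "rights [] = []" "rights (Inl v # p) = rights p" "rights (Inr e # p) = e # rights p"
  by (simp_all add: lefts_def rights_def)

lemma set_lefts: "set (lefts p) = {v. Inl v \<in> set p}"
proof (induction p)
  case (Cons a p)
  then show ?case by (cases a) auto
qed simp

lemma set_rights: "set (rights p) = {e. Inr e \<in> set p}"
proof (induction p)
  case (Cons a p)
  then show ?case by (cases a) auto
qed simp

text \<open>A vertex on a walk that starts at an edge is entered by an arc, and no arc is incident
  with \<open>X\<close>. The start at an edge excludes the walk \<open>[Inl v]\<close>.\<close>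

lemma subdivision_walk_avoids:
  assumes "walk (subdivision G X) p" "hd p = Inr e" "Inl v \<in> set p"
  shows "v \<notin> X"
  using assms
proof (induction p arbitrary: e rule: induct_list012)
  case (3 a b zs)
  from 3(3,4) obtain w where b: "b = Inl w" "w \<notin> X" by (auto simp: subdivision_def)
  show ?case
  proof (cases "v = w")
    case False
    then have "Inl v \<in> set zs" using 3(4,5) b by auto
    moreover from this 3(3) b have "walk (subdivision G X) zs" "\<exists>e. hd zs = Inr e"
      by (cases zs; auto simp: subdivision_def)+
    ultimately show ?thesis using 3(1) by blast
  qed (use b in simp)
qed auto

lemma is_path_Cons:
  assumes "is_path G (v # vs, es)" "e \<in> edges G" "ends G e = {x, v}" "x \<notin> set (v # vs)" "x \<in> verts G"
  shows "is_path G (x # v # vs, e # es)"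
  using assms by (auto simp: is_path_def path_verts_def path_edges_def nth_Cons split: nat.splits)

lemma sep_order_commute: "sep_order G A B = sep_order G B A"
  unfolding sep_order_def crossing_def by (simp add: Un_commute conj_commute)

section \<open>Edges of paths, and independence versus edge-disjointness\<close>

text \<open>An edge of a path joins consecutive vertices. These are the first and the last one, and
  all vertices are distinct, so the path has no other edge.\<close>

lemma path_edge_between_ends:
  assumes "p \<in> paths_between G u v" "u \<noteq> v" "e \<in> path_edges p" "ends G e = {u, v}"
  shows "p = ([u, v], [e])"
proof -
  obtain vs es where p: "p = (vs, es)" by (cases p)
  have l: "length vs = length es + 1" "distinct vs" "hd vs = u" "last vs = v"
    using assms(1) by (auto simp: p paths_between_def is_path_def)
  obtain i where i: "i < length es" "es ! i = e"
    using assms(3) by (auto simp: p path_edges_def in_set_conv_nth)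
  from l(1) have "vs \<noteq> []" by auto
  have "{vs ! i, vs ! (i + 1)} = {u, v}"
    using assms(1,4) i by (auto simp: p paths_between_def is_path_def)
  moreover have uv: "u = vs ! 0" "v = vs ! length es"
    using l \<open>vs \<noteq> []\<close> by (auto simp: hd_conv_nth last_conv_nth)
  moreover have "vs ! (i + 1) \<noteq> vs ! 0"
    using l i by (simp add: nth_eq_iff_index_eq)
  ultimately have "vs ! i = vs ! 0" "vs ! (i + 1) = vs ! length es"
    by (auto simp: doubleton_eq_iff)
  then have "i = 0" "length es = 1"
    using l i by (auto simp: nth_eq_iff_index_eq)
  then have "es = [e]" using i by (cases es) auto
  moreover have "vs = [u, v]"
    using l uv \<open>length es = 1\<close> by (cases vs; cases "tl vs") auto
  ultimately show ?thesis by (simp add: p)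
qed

lemma path_crosses:
  assumes "p \<in> paths_between G u v" "u \<in> A" "v \<notin> A"
  obtains e a b where "e \<in> path_edges p" "ends G e = {a, b}" "a \<in> A" "b \<notin> A"
    "a \<in> path_verts p" "b \<in> path_verts p"
proof -
  obtain vs es where p: "p = (vs, es)" by (cases p)
  have l: "length vs = length es + 1" "hd vs = u" "last vs = v"
    using assms(1) by (auto simp: p paths_between_def is_path_def)
  moreover from l(1) have "vs \<noteq> []" by auto
  ultimately have "vs ! 0 \<in> A" "vs ! length es \<notin> A"
    using assms by (auto simp: hd_conv_nth last_conv_nth)
  \<comment> \<open>\<open>i\<close> is the position just before the first vertex outside
    \<open>A\<close>.\<close>
  then obtain i where i: "i < length es" "vs ! i \<in> A" "vs ! (Suc i) \<notin> A"
    using ex_least_nat_less[of "\<lambda>i. vs ! i \<notin> A" "length es"] by auto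
  have "ends G (es ! i) = {vs ! i, vs ! (Suc i)}"
    using assms(1) i by (auto simp: p paths_between_def is_path_def)
  with i l show ?thesis
    by (intro that[of "es ! i" "vs ! i" "vs ! Suc i"]) (auto simp: p path_edges_def path_verts_def)
qed

text \<open>Both ends of an edge shared by two paths lie on both, so by independence they are
  \<open>u\<close> and \<open>v\<close>. Then each path consists of that edge alone and the two
  coincide.\<close>

lemma independent_imp_edge_disjoint:
  assumes "P \<subseteq> paths_between G u v" "u \<noteq> v" "independent_paths P"
  shows "edge_disjoint_paths P"
  unfolding edge_disjoint_paths_def
proof (intro ballI impI, rule ccontr)
  fix p q assume pq: "p \<in> P" "q \<in> P" "p \<noteq> q" "path_edges p \<inter> path_edges q \<noteq> {}"
  then obtain e where e: "e \<in> path_edges p" "e \<in> path_edges q" by auto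
  have edge: "\<exists>a b. ends G e = {a, b} \<and> a \<noteq> b \<and> a \<in> path_verts r \<and> b \<in> path_verts r"
    if r: "r \<in> P" "e \<in> path_edges r" for r
  proof -
    obtain vs es where p: "r = (vs, es)" by (cases r)
    obtain i where i: "i < length es" "es ! i = e"
      using r(2) by (auto simp: p path_edges_def in_set_conv_nth)
    have l: "length vs = length es + 1" "distinct vs" "ends G e = {vs ! i, vs ! (i + 1)}"
      using r assms(1) i by (auto simp: p paths_between_def is_path_def)
    with i show ?thesis
      by (intro exI[of _ "vs ! i"] exI[of _ "vs ! (i + 1)"])
        (auto simp: p path_verts_def nth_eq_iff_index_eq)
  qed
  obtain a b where ab: "ends G e = {a, b}" "a \<noteq> b" "a \<in> path_verts p" "b \<in> path_verts p"
    using edge[OF pq(1) e(1)] by auto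
  obtain a' b' where ab': "ends G e = {a', b'}" "a' \<in> path_verts q" "b' \<in> path_verts q"
    using edge[OF pq(2) e(2)] by auto
  have "a \<in> path_verts q" "b \<in> path_verts q" using ab ab' by (auto simp: doubleton_eq_iff)
  then have "a \<in> path_ends p" "b \<in> path_ends p"
    using assms(3) pq(1-3) ab unfolding independent_paths_def by blast+
  moreover have "path_ends p = {u, v}"
    using assms(1) pq(1) by (auto simp: path_ends_def paths_between_def)
  ultimately have "ends G e = {u, v}" using ab by auto
  then have "r = ([u, v], [e])" if "r \<in> P" "e \<in> path_edges r" for r
    using path_edge_between_ends[of r G u v e] that assms(1,2) by blast
  then have "p = q" using e pq(1,2) by metis
  with pq(3) show False by simp
qed

context fin_loopless_multigraph
begin

lemma finite_crossing [simp]: "finite (crossing G A B)"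
  using finite_edges by (simp add: crossing_def)

lemma ends_eq:
  assumes "e \<in> edges G" "a \<in> ends G e" "b \<in> ends G e" "a \<noteq> b"
  shows "ends G e = {a, b}"
  using card_ends[OF assms(1)] assms by (auto simp: card_2_iff)

section \<open>From walks in the subdivision to independent paths\<close>

text \<open>The induction strips an edge and a vertex at a time: the first edge leads from
  \<open>x\<close> to the next vertex, which becomes the new \<open>x\<close>.\<close>

lemma subdivision_path:
  assumes "walk (subdivision G X) p" "distinct p" "hd p = Inr e" "e \<in> edges G" "x \<in> ends G e"
    and "last p = Inr e'" "y \<in> ends G e'" "x \<noteq> y" "Inl x \<notin> set p" "Inl y \<notin> set p"
  shows "is_path G (x # lefts p @ [y], rights p)"
  using assms
proof (induction p arbitrary: e x rule: induct_list012)
  case (2 a)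
  then have "e' = e" "a = Inr e" "ends G e = {x, y}" "x \<in> verts G" "y \<in> verts G"
    using ends_eq[of e x y] ends_subset[of e] by auto
  with 2 show ?case by (auto simp: is_path_def path_verts_def path_edges_def)
next
  case (3 a b zs)
  from 3 obtain v where b: "b = Inl v" "v \<in> ends G e" by (auto simp: subdivision_def)
  with 3 have "zs \<noteq> []" by auto
  with 3(3) b(1) obtain f zs' where zs: "zs = Inr f # zs'" "f \<in> edges G" "v \<in> ends G f"
    by (cases zs) (auto simp: subdivision_def)
  have "is_path G (v # lefts zs @ [y], rights zs)"
    by (rule 3(1)[of f]) (use 3 zs b in auto)
  moreover have "ends G e = {x, v}" "x \<in> verts G"
    using ends_eq[of e x v] 3(6-10) b ends_subset[of e] 3(11) by auto
  ultimately have "is_path G (x # v # lefts zs @ [y], e # rights zs)"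
    using 3 b by (intro is_path_Cons) (auto simp: set_lefts)
  then show ?case using 3 b by simp
qed auto

lemma finite_subdivision: "finite (subdivision G X)"
proof (rule finite_subset)
  let ?U = "Inl ` verts G \<union> Inr ` edges G"
  show "subdivision G X \<subseteq> ?U \<times> ?U"
    using ends_subset by (auto simp: subdivision_def)
qed (simp add: finite_verts finite_edges)

text \<open>\<open>menger\<close> is applied between the edges at \<open>x\<close> and the edges at
  \<open>y\<close>, so a separator \<open>T\<close> mixes vertices and edges. It is turned into a
  separation of order at most \<open>card T\<close>.\<close>

theorem mixed_menger:
  assumes "x \<in> verts G" "y \<in> verts G" "x \<noteq> y"
    and order: "\<And>A B. A \<subseteq> verts G \<Longrightarrow> B \<subseteq> verts G \<Longrightarrow> A \<inter> B = {} \<Longrightarrow> x \<in> A \<Longrightarrow> y \<in> B \<Longrightarrow>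
      k \<le> sep_order G A B"
  shows "\<exists>P \<subseteq> paths_between G x y. independent_paths P \<and> card P = k"
proof -
  let ?R = "subdivision G {x, y}"
  let ?X = "Inr ` {e \<in> edges G. x \<in> ends G e}" and ?Y = "Inr ` {e \<in> edges G. y \<in> ends G e}"
  have "\<exists>Q. linkage ?R ?X ?Y Q \<and> finite Q \<and> card Q = k"
  proof (rule menger)
    fix T :: "('v + 'e) set"
    assume T: "finite T" "separates ?R ?X ?Y T"
    define reach where "reach v \<longleftrightarrow> (\<exists>p. walk ?R p \<and> hd p \<in> ?X \<and> last p = Inl v \<and> set p \<inter> T = {})" for v
    \<comment> \<open>\<open>A\<close> collects \<open>x\<close> and what is reachable while
      avoiding \<open>T\<close>, and \<open>B\<close> collects \<open>y\<close> and the remaining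
      vertices outside \<open>T\<close>; all other vertices are then in \<open>T\<close>.\<close>
    define A where "A = insert x {v \<in> verts G - {y}. reach v}"
    define B where "B = insert y {v \<in> verts G - A. Inl v \<notin> T}"
    have "y \<notin> A" using assms(3) by (auto simp: A_def)
    have "k \<le> sep_order G A B"
      by (rule order) (use assms \<open>y \<notin> A\<close> in \<open>auto simp: A_def B_def\<close>)
    also have "\<dots> \<le> card (Inl -` T :: 'v set) + card (Inr -` T :: 'e set)"
      unfolding sep_order_def
    proof (intro add_mono card_mono)
      show "verts G - (A \<union> B) \<subseteq> Inl -` T" by (auto simp: B_def)
      show "crossing G A B \<subseteq> Inr -` T"
      \<comment> \<open>A crossing edge outside \<open>T\<close> can be reached while avoiding
        \<open>T\<close>. It either ends at \<open>y\<close>, contradicting separation, or makes its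
        end in \<open>B\<close> reachable.\<close>
      proof (rule subsetI, rule ccontr)
        fix e assume e: "e \<in> crossing G A B" "e \<notin> Inr -` T"
        then obtain a b where ab: "e \<in> edges G" "a \<in> ends G e" "a \<in> A" "b \<in> ends G e" "b \<in> B"
          by (auto simp: crossing_def)
        have "\<exists>p. walk ?R p \<and> hd p \<in> ?X \<and> last p = Inr e \<and> set p \<inter> T = {}"
        proof (cases "a = x")
          case True
          then show ?thesis using e ab by (intro exI[of _ "[Inr e]"]) auto
        next
          case False
          then obtain p where p: "walk ?R p" "hd p \<in> ?X" "last p = Inl a" "set p \<inter> T = {}"
            using ab(3) by (auto simp: A_def reach_def)
          have "a \<noteq> y" using ab \<open>y \<notin> A\<close> by auto
          then have "(Inl a, Inr e) \<in> ?R" using False ab by (auto simp: subdivision_def)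
          then show ?thesis using p e walk_nonempty[OF p(1)]
            by (intro exI[of _ "p @ [Inr e]"]) (auto simp: walk_append)
        qed
        then obtain p where p: "walk ?R p" "hd p \<in> ?X" "last p = Inr e" "set p \<inter> T = {}" by auto
        show False
        proof (cases "b = y")
          case True
          then have "last p \<in> ?Y" using p ab by auto
          then show False using p T(2) unfolding separates_def by blast
        next
          case False
          have "b \<notin> A" using ab(5) \<open>y \<notin> A\<close> by (auto simp: B_def)
          then have "b \<noteq> x" by (auto simp: A_def)
          then have "(Inr e, Inl b) \<in> ?R" using False ab by (auto simp: subdivision_def)
          then have "reach b" unfolding reach_def
            using p ab(5) False walk_nonempty[OF p(1)]
            by (intro exI[of _ "p @ [Inl b]"]) (auto simp: walk_append B_def)
          moreover have "b \<in> verts G" using ab(1,4) ends_subset by auto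
          ultimately show False using \<open>b \<notin> A\<close> False by (auto simp: A_def)
        qed
      qed
    qed (use T(1) in \<open>auto intro!: finite_vimageI\<close>)
    also have "\<dots> = card (Inl ` (Inl -` T :: 'v set) \<union> Inr ` (Inr -` T :: 'e set))"
      using T(1) by (subst card_Un_disjoint)
        (auto simp: card_image finite_vimageI simp del: image_vimage_eq)
    also have "\<dots> \<le> card T" using T(1) by (intro card_mono) auto
    finally show "k \<le> card T" .
  next
    show "irrefl ?R" by (auto simp: irrefl_def subdivision_def)
  qed (simp_all add: finite_subdivision finite_edges)
  then obtain Q where Q: "linkage ?R ?X ?Y Q" "finite Q" "card Q = k" by blast
  define path where "path p = (x # lefts p @ [y], rights p)" for p :: "('v + 'e) list"
  have Qw: "walk ?R q" "distinct q" "hd q \<in> ?X" "last q \<in> ?Y" if "q \<in> Q" for q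
    using Q(1) that unfolding linkage_def by auto
  have Qd: "set p \<inter> set q = {}" if "p \<in> Q" "q \<in> Q" "p \<noteq> q" for p q
    using Q(1) that unfolding linkage_def by auto
  have verts: "path_verts (path q) = {x, y} \<union> {v. Inl v \<in> set q}" for q
    by (auto simp: path_verts_def path_def set_lefts)
  have "path q \<in> paths_between G x y" if q: "q \<in> Q" for q
  proof -
    obtain e e' where e: "hd q = Inr e" "e \<in> edges G" "x \<in> ends G e" "last q = Inr e'" "y \<in> ends G e'"
      using Qw(3,4)[OF q] by auto
    have "Inl v \<notin> set q" if "v \<in> {x, y}" for v
      using subdivision_walk_avoids[OF Qw(1)[OF q] e(1)] that by blast
    then have "is_path G (path q)"
      unfolding path_def
      using e assms(3) by (intro subdivision_path[OF Qw(1,2)[OF q] e(1-5)]) auto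
    then show ?thesis by (simp add: paths_between_def path_def)
  qed
  \<comment> \<open>No paths are lost: each walk starts at an edge, which its path records, and
    different walks share no edge.\<close>
  moreover have "inj_on path Q"
  proof (rule inj_onI, rule ccontr)
    fix p q assume pq: "p \<in> Q" "q \<in> Q" "path p = path q" "p \<noteq> q"
    obtain e where e: "hd p = Inr e" using Qw(3)[OF pq(1)] by auto
    have "e \<in> set (rights p)"
      using e walk_nonempty[OF Qw(1)[OF pq(1)]] hd_in_set[of p] by (auto simp: set_rights)
    moreover have "rights p = rights q" using pq(3) by (simp add: path_def)
    ultimately have "Inr e \<in> set p" "Inr e \<in> set q"
      by (metis mem_Collect_eq set_rights)+
    then show False using Qd pq by blast
  qed
  moreover have "independent_paths (path ` Q)"
    unfolding independent_paths_def
  proof (intro allI impI ballI)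
    fix z r assume z: "\<exists>p\<in>path ` Q. \<exists>q\<in>path ` Q. p \<noteq> q \<and> z \<in> path_verts p \<and> z \<in> path_verts q"
      and "r \<in> path ` Q"
    from z obtain p q where "p \<in> Q" "q \<in> Q" "p \<noteq> q" "z \<in> path_verts (path p)" "z \<in> path_verts (path q)"
      by auto
    then have "z \<in> {x, y}" using Qd[of p q] by (auto simp: verts)
    then show "z \<in> path_ends r" using \<open>r \<in> path ` Q\<close> by (auto simp: path_def path_ends_def)
  qed
  ultimately show ?thesis using Q(3)
    by (intro exI[of _ "path ` Q"]) (auto simp: card_image)
qed

section \<open>Orders of separations under connectivity assumptions\<close>

text \<open>Taking \<open>a\<close> out of \<open>A\<close> adds at most one vertex to the separator
  and releases the edges of \<open>M\<close>, which have no other end in \<open>A\<close>.\<close>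

lemma sep_order_Diff:
  assumes "A \<subseteq> verts G" "A \<inter> B = {}" "a \<in> A"
    and M: "M \<subseteq> crossing G A B" "\<And>e. e \<in> M \<Longrightarrow> ends G e \<inter> A \<subseteq> {a}"
  shows "sep_order G (A - {a}) B + card M \<le> sep_order G A B + 1"
proof -
  have "verts G - ((A - {a}) \<union> B) = insert a (verts G - (A \<union> B))" using assms(1-3) by auto
  then have "card (verts G - ((A - {a}) \<union> B)) \<le> card (verts G - (A \<union> B)) + 1"
    using card_insert_le_m1 finite_verts by (simp add: card_insert_if)
  moreover have "finite M" using M(1) finite_subset finite_crossing by blast
  then have "card (crossing G (A - {a}) B) + card M = card (crossing G (A - {a}) B \<union> M)"
    using M(2) \<open>finite M\<close>
    by (intro card_Un_disjoint[symmetric] finite_crossing) (auto simp: crossing_def)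
  moreover have "\<dots> \<le> card (crossing G A B)"
    using M(1) by (intro card_mono finite_crossing) (auto simp: crossing_def)
  ultimately show ?thesis unfolding sep_order_def by linarith
qed

lemma crossing_end_unique:
  assumes "e \<in> edges G" "a \<in> ends G e" "a \<in> A" "b \<in> ends G e" "b \<in> B" "A \<inter> B = {}"
  shows "ends G e \<inter> A \<subseteq> {a}"
proof -
  have "ends G e = {a, b}" using assms by (intro ends_eq) auto
  then show ?thesis using assms by auto
qed

text \<open>In the graph induced on \<open>A \<union> B\<close>, a path from \<open>A\<close> to
  \<open>B\<close> leaves \<open>A\<close> along an edge whose other end must be in
  \<open>B\<close>.\<close>

lemma connected_crossing:
  assumes "connected_graph (delete_verts G (verts G - (A \<union> B)))"
    and "A \<subseteq> verts G" "B \<subseteq> verts G" "A \<inter> B = {}" "A \<noteq> {}" "B \<noteq> {}"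
  shows "crossing G A B \<noteq> {}"
proof -
  let ?H = "delete_verts G (verts G - (A \<union> B))"
  have V: "verts ?H = A \<union> B" using assms(2,3) by (auto simp: delete_verts_def)
  obtain a b where "a \<in> A" "b \<in> B" using assms(5,6) by auto
  then obtain p where p: "p \<in> paths_between ?H a b"
    using assms(1) V unfolding connected_graph_def by blast
  have "b \<notin> A" using \<open>b \<in> B\<close> assms(4) by auto
  obtain e c d where e: "e \<in> path_edges p" "ends ?H e = {c, d}" "c \<in> A" "d \<notin> A"
    "c \<in> path_verts p" "d \<in> path_verts p"
    using path_crosses[OF p \<open>a \<in> A\<close> \<open>b \<notin> A\<close>] .
  have "is_path ?H p" using p by (simp add: paths_between_def)
  then have "e \<in> edges ?H" "d \<in> A \<union> B" using e V by (auto simp: is_path_def)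
  then have "e \<in> crossing G A B"
    using e by (auto simp: crossing_def delete_verts_def)
  then show ?thesis by auto
qed

text \<open>If no edge crosses, the vertices outside \<open>A \<union> B\<close> disconnect the
  graph. Otherwise a crossing edge is traded for one of its ends without raising the order, as long
  as that empties neither side. Two singletons leave at least \<open>k - 1\<close> vertices outside,
  plus a crossing edge.\<close>

theorem k_connected_imp_sep_order_ge:
  assumes "k_connected k G" "A \<subseteq> verts G" "B \<subseteq> verts G" "A \<inter> B = {}" "A \<noteq> {}" "B \<noteq> {}"
  shows "k \<le> sep_order G A B"
  using assms
proof (induction "card A + card B" arbitrary: A B rule: less_induct)
  case less
  have fin: "finite A" "finite B" using less.prems finite_verts finite_subset by blast+
  show ?case
  proof (cases "crossing G A B = {}")
    case True
    have "\<not> connected_graph (delete_verts G (verts G - (A \<union> B)))"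
      using connected_crossing[OF _ less.prems(2-6)] True by blast
    then have "k \<le> card (verts G - (A \<union> B))"
      using less.prems(1) unfolding k_connected_def by (meson Diff_subset not_le)
    then show ?thesis by (simp add: sep_order_def)
  next
    case False
    then obtain e a b where e: "e \<in> edges G" "a \<in> ends G e" "a \<in> A" "b \<in> ends G e" "b \<in> B"
      by (auto simp: crossing_def)
    then have eC: "{e} \<subseteq> crossing G A B" "{e} \<subseteq> crossing G B A" by (auto simp: crossing_def)
    have BA: "B \<inter> A = {}" using less.prems(4) by auto
    consider "A - {a} \<noteq> {}" | "B - {b} \<noteq> {}" | "A = {a}" "B = {b}" using e by blast
    then show ?thesis
    proof cases
      case 1
      have "card (A - {a}) < card A" using e(3) fin(1) by (rule card_Diff1_less[rotated])
      then have "k \<le> sep_order G (A - {a}) B"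
        using less.prems 1 by (intro less.hyps) auto
      then show ?thesis
        using sep_order_Diff[OF less.prems(2,4) e(3) eC(1)]
          crossing_end_unique[OF e less.prems(4)] by simp
    next
      case 2
      have "card (B - {b}) < card B" using e(5) fin(2) by (rule card_Diff1_less[rotated])
      then have "k \<le> sep_order G A (B - {b})"
        using less.prems 2 by (intro less.hyps) auto
      then show ?thesis
        using sep_order_Diff[OF less.prems(3) BA e(5) eC(2)]
          crossing_end_unique[OF e(1,4,5,2,3) BA] by (simp add: sep_order_commute[of G A])
    next
      case 3
      have "card (crossing G A B) > 0" using False by (simp add: card_gt_0_iff)
      moreover have "card (verts G - (A \<union> B)) + card (A \<union> B) = card (verts G)"
        using less.prems(2,3) fin
        by (metis Un_least card_Diff_subset card_mono finite_Un finite_verts le_add_diff_inverse2)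
      moreover have "card (A \<union> B) \<le> 2" using 3 by (simp add: card_insert_if)
      ultimately show ?thesis using less.prems(1) unfolding k_connected_def sep_order_def by linarith
    qed
  qed
qed

text \<open>Otherwise \<open>mixed_menger\<close> would give \<open>k + 1\<close> independent
  paths.\<close>

lemma max_independent_paths_imp_sep_order_le:
  assumes "u \<in> verts G" "v \<in> verts G" "u \<noteq> v" "max_independent_paths G u v = k"
  obtains A B where "A \<subseteq> verts G" "B \<subseteq> verts G" "A \<inter> B = {}" "u \<in> A" "v \<in> B" "sep_order G A B \<le> k"
proof (rule ccontr)
  note sep = that
  assume contra: "\<not> thesis"
  have "Suc k \<le> sep_order G A B"
    if "A \<subseteq> verts G" "B \<subseteq> verts G" "A \<inter> B = {}" "u \<in> A" "v \<in> B" for A B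
    using contra sep[OF that] by (cases "sep_order G A B \<le> k") auto
  then have "\<exists>P\<subseteq>paths_between G u v. independent_paths P \<and> card P = Suc k"
    by (rule mixed_menger[OF assms(1-3)])
  then obtain P where "P \<subseteq> paths_between G u v" "independent_paths P" "card P = Suc k"
    by blast
  moreover have "card P \<le> k"
    using assms(4) calculation(1,2) unfolding max_independent_paths_eq_iff by blast
  ultimately show False by simp
qed

text \<open>Each vertex of \<open>S\<close> other than \<open>u\<close> and \<open>v\<close> lies on
  at most one of \<open>k\<close> independent paths between them, so fewer than \<open>k\<close>
  deletions leave a path intact.\<close>

lemma uniformly_k_connected_imp_k_connected:
  assumes "uniformly_k_connected k G"
  shows "k_connected k G"
  unfolding k_connected_def
proof (intro conjI allI impI)
  show "k + 1 \<le> card (verts G)" using assms by (simp add: uniformly_k_connected_def)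
  fix S assume S: "S \<subseteq> verts G" "card S < k"
  let ?H = "delete_verts G S"
  have finS: "finite S" using S finite_verts finite_subset by blast
  have V: "verts ?H = verts G - S" by (simp add: delete_verts_def)
  have "card (verts ?H) > 0"
    using assms S finS by (simp add: V card_Diff_subset uniformly_k_connected_def)
  moreover have "paths_between ?H u v \<noteq> {}" if uv: "u \<in> verts ?H" "v \<in> verts ?H" for u v
  proof (cases "u = v")
    case True
    then have "([u], []) \<in> paths_between ?H u v"
      using uv by (auto simp: paths_between_def is_path_def path_verts_def path_edges_def)
    then show ?thesis by auto
  next
    case False
    then have "max_independent_paths G u v = k"
      using assms uv unfolding uniformly_k_connected_def V by blast
    then obtain P where P: "P \<subseteq> paths_between G u v" "independent_paths P" "card P = k"
      unfolding max_independent_paths_eq_iff by blast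
    have "\<exists>p\<in>P. path_verts p \<inter> S = {}"
    proof (rule ccontr)
      assume "\<not> ?thesis"
      then have "\<forall>p\<in>P. \<exists>s. s \<in> path_verts p \<inter> S" by blast
      then obtain f where f: "\<And>p. p \<in> P \<Longrightarrow> f p \<in> path_verts p \<inter> S" by metis
      have "inj_on f P"
      proof (rule inj_onI, rule ccontr)
        fix p q assume pq: "p \<in> P" "q \<in> P" "f p = f q" "p \<noteq> q"
        then have "f p \<in> path_ends p"
          using P(2) f[of p] f[of q] unfolding independent_paths_def by (metis IntD1)
        moreover have "path_ends p = {u, v}"
          using P(1) pq(1) by (auto simp: path_ends_def paths_between_def)
        ultimately show False using f[of p] pq(1) uv by (auto simp: V)
      qed
      then have "card P \<le> card S" using f finS by (intro card_inj_on_le) auto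
      then show False using P S by simp
    qed
    then obtain p where p: "p \<in> P" "path_verts p \<inter> S = {}" by blast
    then have path: "is_path G p" "hd (fst p) = u" "last (fst p) = v"
      using P(1) by (auto simp: paths_between_def)
    have "e \<in> edges ?H" if e: "e \<in> path_edges p" for e
    proof -
      obtain i where i: "i < length (snd p)" "snd p ! i = e"
        using e by (auto simp: path_edges_def in_set_conv_nth)
      then have "ends G e = {fst p ! i, fst p ! (i + 1)}" "length (fst p) = length (snd p) + 1"
        using path(1) by (auto simp: is_path_def)
      then have "ends G e \<subseteq> path_verts p" using i by (auto simp: path_verts_def)
      then show ?thesis using p(2) path(1) e by (auto simp: delete_verts_def is_path_def)
    qed
    then have "p \<in> paths_between ?H u v"
      using path p(2) by (auto simp: paths_between_def is_path_def delete_verts_def)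
    then show ?thesis by auto
  qed
  ultimately show "connected_graph ?H" unfolding connected_graph_def by (metis card.empty less_irrefl)
qed

text \<open>Two parallel edges both cross a separation of order at most 3 between \<open>x\<close>
  and \<open>y\<close>. Taking \<open>x\<close> out of \<open>A\<close>, or \<open>y\<close> out of
  \<open>B\<close>, trades both for one vertex and leaves order at most 2, against 3-connectivity.
  If both sides are singletons, two outside vertices and two edges already give order 4.\<close>

lemma uniformly_3_connected_multiplicity_le_1:
  assumes "uniformly_k_connected 3 G" "x \<in> verts G" "y \<in> verts G" "x \<noteq> y"
  shows "card {e \<in> edges G. ends G e = {x, y}} \<le> 1"
proof (rule ccontr)
  let ?M = "{e \<in> edges G. ends G e = {x, y}}"
  assume "\<not> card ?M \<le> 1"
  then have M: "card ?M \<ge> 2" by simp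
  have conn: "k_connected 3 G" using assms(1) by (rule uniformly_k_connected_imp_k_connected)
  obtain A B where AB: "A \<subseteq> verts G" "B \<subseteq> verts G" "A \<inter> B = {}" "x \<in> A" "y \<in> B" "sep_order G A B \<le> 3"
    using max_independent_paths_imp_sep_order_le assms unfolding uniformly_k_connected_def by metis
  have fin: "finite A" "finite B" using AB finite_verts finite_subset by blast+
  have BA: "B \<inter> A = {}" using AB(3) by auto
  have MC: "?M \<subseteq> crossing G A B" "?M \<subseteq> crossing G B A" using AB by (auto simp: crossing_def)
  consider "A - {x} \<noteq> {}" | "B - {y} \<noteq> {}" | "A = {x}" "B = {y}" using AB by blast
  then show False
  proof cases
    case 1
    have "sep_order G (A - {x}) B + card ?M \<le> sep_order G A B + 1"
      using AB BA MC(1) by (intro sep_order_Diff) auto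
    moreover have "3 \<le> sep_order G (A - {x}) B"
      using AB 1 by (intro k_connected_imp_sep_order_ge[OF conn]) auto
    ultimately show False using AB(6) M by linarith
  next
    case 2
    have "sep_order G (B - {y}) A + card ?M \<le> sep_order G B A + 1"
      using AB BA MC(2) by (intro sep_order_Diff) auto
    moreover have "3 \<le> sep_order G (B - {y}) A"
      using AB 2 by (intro k_connected_imp_sep_order_ge[OF conn]) auto
    ultimately show False using AB(6) M by (simp add: sep_order_commute[of G B])
  next
    case 3
    have "card ?M \<le> card (crossing G A B)" using MC by (intro card_mono) auto
    moreover have "card (verts G - (A \<union> B)) + card (A \<union> B) = card (verts G)"
      using AB(1,2) fin
      by (metis Un_least card_Diff_subset card_mono finite_Un finite_verts le_add_diff_inverse2)
    moreover have "card (A \<union> B) \<le> 2" using 3 by (simp add: card_insert_if)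
    ultimately show False using conn AB(6) M unfolding k_connected_def sep_order_def by linarith
  qed
qed

section \<open>Bounding edge-disjoint paths in uniformly 3-connected graphs\<close>

lemma edge_disjoint_card_le:
  assumes P: "P \<subseteq> paths_between G u v" "edge_disjoint_paths P" and "u \<notin> B" "v \<in> B"
  shows "card P \<le> card (crossing G (verts G - B) B)"
proof -
  have "\<exists>e. e \<in> path_edges p \<and> e \<in> crossing G (verts G - B) B" if p: "p \<in> P" for p
  proof -
    have path: "p \<in> paths_between G u v" using P(1) p by auto
    obtain e a b where e: "e \<in> path_edges p" "ends G e = {a, b}" "a \<in> - B" "b \<notin> - B"
      "a \<in> path_verts p" "b \<in> path_verts p"
      using path_crosses[OF path, of "- B"] assms(3,4) by auto
    then have "e \<in> edges G" "a \<in> verts G"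
      using path by (auto simp: paths_between_def is_path_def)
    with e show ?thesis by (auto simp: crossing_def)
  qed
  then obtain f where f: "\<And>p. p \<in> P \<Longrightarrow> f p \<in> path_edges p \<and> f p \<in> crossing G (verts G - B) B"
    by metis
  have "inj_on f P"
    using f P(2) unfolding edge_disjoint_paths_def inj_on_def by (metis disjoint_iff)
  then show ?thesis using f by (intro card_inj_on_le) auto
qed

text \<open>An edge from \<open>s\<close> to \<open>A' \<inter> B\<close> crosses
  \<open>(A', B')\<close>, but neither of the two combined separations: it has no end in
  \<open>A\<close> and none in \<open>B \<inter> B'\<close>. This gives the extra term.\<close>

lemma sep_order_submodular:
  assumes "A \<inter> B = {}" "A' \<inter> B' = {}" "s \<in> B'" "s \<notin> A \<union> B"
  shows "sep_order G (A \<inter> A') (B \<union> B') + sep_order G (A \<union> A') (B \<inter> B') +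
      card (crossing G {s} (A' \<inter> B)) \<le> sep_order G A B + sep_order G A' B'"
proof -
  \<comment> \<open>It suffices that what is counted on the left is counted on the right, and what
    is counted twice on the left is counted twice on the right.\<close>
  have submod: "card X + card Y \<le> card Z + card W"
    if "X \<union> Y \<subseteq> Z \<union> W" "X \<inter> Y \<subseteq> Z \<inter> W" "finite Z" "finite W" for X Y Z W :: "'c set"
  proof -
    have "finite X" "finite Y" using that finite_subset[of X "Z \<union> W"] finite_subset[of Y "Z \<union> W"] by auto
    then have "card X + card Y = card (X \<union> Y) + card (X \<inter> Y)" by (rule card_Un_Int)
    also have "\<dots> \<le> card (Z \<union> W) + card (Z \<inter> W)"
      using that by (intro add_mono card_mono) auto
    also have "\<dots> = card Z + card W" using that by (intro card_Un_Int[symmetric])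
    finally show ?thesis .
  qed
  let ?X = "crossing G (A \<inter> A') (B \<union> B')" and ?Y = "crossing G (A \<union> A') (B \<inter> B')"
  let ?N = "crossing G {s} (A' \<inter> B)"
  have N: "ends G e = {s, b}" if "e \<in> crossing G {s} (A' \<inter> B)" "b \<in> ends G e" "b \<in> A' \<inter> B" for e b
    using that assms by (intro ends_eq) (auto simp: crossing_def)
  have disj: "?X \<inter> ?N = {}" "?Y \<inter> ?N = {}"
  proof -
    have "ends G e \<inter> (A \<inter> A') = {} \<and> ends G e \<inter> (B \<inter> B') = {}" if e: "e \<in> ?N" for e
    proof -
      obtain b where b: "b \<in> ends G e" "b \<in> A' \<inter> B" using e by (auto simp: crossing_def)
      show ?thesis unfolding N[OF e b] using b assms by auto
    qed
    then show "?X \<inter> ?N = {}" "?Y \<inter> ?N = {}" by (auto simp: crossing_def)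
  qed
  have "card ?X + card (?Y \<union> ?N) \<le> card (crossing G A B) + card (crossing G A' B')"
    using disj assms(3) by (intro submod finite_crossing) (auto simp: crossing_def)
  moreover have "card (?Y \<union> ?N) = card ?Y + card ?N" using disj by (intro card_Un_disjoint finite_crossing)
  moreover have "card (verts G - ((A \<inter> A') \<union> (B \<union> B'))) + card (verts G - ((A \<union> A') \<union> (B \<inter> B')))
      \<le> card (verts G - (A \<union> B)) + card (verts G - (A' \<union> B'))"
    using finite_verts by (intro submod) auto
  ultimately show ?thesis unfolding sep_order_def by linarith
qed

theorem uniformly_3_connected_edge_disjoint_le_3:
  assumes unif: "uniformly_k_connected 3 G" and uv: "u \<in> verts G" "v \<in> verts G" "u \<noteq> v"
    and P: "P \<subseteq> paths_between G u v" "edge_disjoint_paths P"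
  shows "card P \<le> 3"
proof (rule ccontr)
  assume "\<not> card P \<le> 3"
  have conn: "k_connected 3 G" using unif by (rule uniformly_k_connected_imp_k_connected)
  define sep where "sep A B \<longleftrightarrow> A \<subseteq> verts G \<and> B \<subseteq> verts G \<and> A \<inter> B = {} \<and> u \<in> A \<and> v \<in> B \<and>
    sep_order G A B \<le> 3" for A B
  obtain A0 B0 where AB0: "sep A0 B0"
    using max_independent_paths_imp_sep_order_le unif uv unfolding uniformly_k_connected_def sep_def
    by metis
  obtain A where A: "\<exists>B. sep A B" "\<And>A' B'. sep A' B' \<Longrightarrow> card A \<le> card A'"
    using ex_has_least_nat[of "\<lambda>A. \<exists>B. sep A B" A0 card] AB0 by metis
  \<comment> \<open>Minimising the complement makes \<open>B\<close> largest.\<close>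
  obtain B where B: "sep A B" "\<And>B'. sep A B' \<Longrightarrow> card (verts G - B) \<le> card (verts G - B')"
    using ex_has_least_nat[of "\<lambda>B. sep A B" _ "\<lambda>B. card (verts G - B)"] A(1) by metis
  have AB: "A \<subseteq> verts G" "B \<subseteq> verts G" "A \<inter> B = {}" "u \<in> A" "v \<in> B" "sep_order G A B \<le> 3"
    using B(1) by (auto simp: sep_def)
  let ?S = "verts G - (A \<union> B)"
  have finS: "finite ?S" using finite_verts by simp
  \<comment> \<open>If each outside vertex sent at most one edge into \<open>B\<close>, at most
    \<open>sep_order G A B\<close> edges would enter \<open>B\<close>, too few for four
    edge-disjoint paths.\<close>
  obtain s where s: "s \<in> ?S" "card (crossing G {s} B) \<ge> 2"
  proof (rule ccontr)
    note s = that
    assume "\<not> thesis"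
    then have le: "card (crossing G {s} B) \<le> 1" if "s \<in> ?S" for s
      using s[of s] that by force
    have "card P \<le> card (crossing G (verts G - B) B)"
      using AB by (intro edge_disjoint_card_le[OF P]) auto
    also have "\<dots> \<le> card (crossing G A B \<union> (\<Union>s\<in>?S. crossing G {s} B))"
      using finS by (intro card_mono finite_UnI finite_UN_I finite_crossing) (auto simp: crossing_def)
    also have "\<dots> \<le> card (crossing G A B) + card (\<Union>s\<in>?S. crossing G {s} B)"
      by (rule card_Un_le)
    also have "card (\<Union>s\<in>?S. crossing G {s} B) \<le> (\<Sum>s\<in>?S. card (crossing G {s} B))"
      using finS by (rule card_UN_le)
    also have "\<dots> \<le> (\<Sum>s\<in>?S. 1)" using le by (intro sum_mono) auto
    finally show False using AB(6) \<open>\<not> card P \<le> 3\<close> by (simp add: sep_order_def)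
  qed
  obtain A' B' where AB': "A' \<subseteq> verts G" "B' \<subseteq> verts G" "A' \<inter> B' = {}" "u \<in> A'" "s \<in> B'"
    "sep_order G A' B' \<le> 3"
    using max_independent_paths_imp_sep_order_le[of u s 3] unif uv s AB(4)
    unfolding uniformly_k_connected_def by (metis DiffD1 DiffD2 UnI1)
  \<comment> \<open>Minimality of \<open>A\<close> would force \<open>A \<inter> A' = A\<close>, and
    then \<open>B \<union> B'\<close>, which contains \<open>s\<close>, would beat
    \<open>B\<close>.\<close>
  have "\<not> sep (A \<inter> A') (B \<union> B')"
  proof
    assume sep: "sep (A \<inter> A') (B \<union> B')"
    have "A \<inter> A' = A"
      using A(2)[OF sep] AB(1) finite_verts by (meson card_seteq finite_subset inf_le1)
    then have "card (verts G - B) \<le> card (verts G - (B \<union> B'))" using B(2) sep by simp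
    moreover have "card (verts G - (B \<union> B')) < card (verts G - B)"
      using finite_verts s AB'(5) by (intro psubset_card_mono) auto
    ultimately show False by simp
  qed
  then have four: "sep_order G (A \<inter> A') (B \<union> B') \<ge> 4"
    using AB AB' unfolding sep_def by auto
  have submod: "sep_order G (A \<inter> A') (B \<union> B') + sep_order G (A \<union> A') (B \<inter> B') +
      card (crossing G {s} (A' \<inter> B)) \<le> 6"
    using sep_order_submodular[OF AB(3) AB'(3,5)] s AB(6) AB'(6) by fastforce
  have "B \<inter> B' = {}"
  proof (rule ccontr)
    assume "B \<inter> B' \<noteq> {}"
    then have "3 \<le> sep_order G (A \<union> A') (B \<inter> B')"
      using AB AB' by (intro k_connected_imp_sep_order_ge[OF conn]) auto
    then show False using four submod by linarith
  qed
  \<comment> \<open>As \<open>B \<inter> B'\<close> is empty, \<open>s\<close> and all of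
    \<open>B - A'\<close> outside \<open>A\<close> count as separator vertices; \<open>B\<close> is
    disjoint from \<open>A\<close>.\<close>
  have "card (insert s (B - A')) \<le> card (verts G - ((A \<union> A') \<union> (B \<inter> B')))"
    using \<open>B \<inter> B' = {}\<close> AB AB' s finite_verts by (intro card_mono) auto
  moreover have finB: "finite (B - A')" using AB(2) finite_verts finite_subset by blast
  ultimately have "1 + card (B - A') \<le> sep_order G (A \<union> A') (B \<inter> B')"
    using s unfolding sep_order_def by simp
  moreover have "card (crossing G {s} B) \<le> card (crossing G {s} (A' \<inter> B)) + card (B - A')"
  proof -
    have "crossing G {s} B \<subseteq>
        crossing G {s} (A' \<inter> B) \<union> (\<Union>b\<in>B - A'. {e \<in> edges G. ends G e = {s, b}})"
    proof
      fix e assume e: "e \<in> crossing G {s} B"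
      then obtain b where b: "e \<in> edges G" "s \<in> ends G e" "b \<in> ends G e" "b \<in> B"
        by (auto simp: crossing_def)
      then have "ends G e = {s, b}" using s by (intro ends_eq) auto
      with b show "e \<in> crossing G {s} (A' \<inter> B) \<union> (\<Union>b\<in>B - A'. {e \<in> edges G. ends G e = {s, b}})"
        by (cases "b \<in> A'") (auto simp: crossing_def)
    qed
    then have "card (crossing G {s} B) \<le>
        card (crossing G {s} (A' \<inter> B) \<union> (\<Union>b\<in>B - A'. {e \<in> edges G. ends G e = {s, b}}))"
      using finB finite_edges by (intro card_mono) auto
    also have "\<dots> \<le> card (crossing G {s} (A' \<inter> B)) + card (\<Union>b\<in>B - A'. {e \<in> edges G. ends G e = {s, b}})"
      by (rule card_Un_le)
    also have "card (\<Union>b\<in>B - A'. {e \<in> edges G. ends G e = {s, b}}) \<le>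
        (\<Sum>b\<in>B - A'. card {e \<in> edges G. ends G e = {s, b}})"
      using finB by (rule card_UN_le)
    also have "\<dots> \<le> (\<Sum>b\<in>B - A'. 1)"
      using s AB(2) by (intro sum_mono uniformly_3_connected_multiplicity_le_1[OF unif]) auto
    finally show ?thesis by simp
  qed
  \<comment> \<open>The left side of \<open>submod\<close> is at least 4 + 1 + 2: the 2 edges from
    \<open>s\<close> into \<open>B\<close> are covered by \<open>B - A'\<close> and the extra
    term.\<close>
  ultimately show False using four submod s(2) by linarith
qed

end

theorem corollary9:
  fixes G :: "('v, 'e) multigraph"
  assumes "fin_loopless_multigraph G"
  shows "uniformly_k_connected 3 G \<longleftrightarrow> k_connected 3 G \<and> uniformly_k_edge_connected 3 G"
proof -
  interpret fin_loopless_multigraph G by (rule assms)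
  show ?thesis
  proof (intro iffI conjI)
    assume unif: "uniformly_k_connected 3 G"
    then show "k_connected 3 G" by (rule uniformly_k_connected_imp_k_connected)
    show "uniformly_k_edge_connected 3 G"
      unfolding uniformly_k_edge_connected_def max_edge_disjoint_paths_eq_iff
    proof (intro conjI ballI impI allI)
      show "2 \<le> card (verts G)" using unif by (simp add: uniformly_k_connected_def)
      fix u v assume uv: "u \<in> verts G" "v \<in> verts G" "u \<noteq> v"
      then have "max_independent_paths G u v = 3" using unif by (simp add: uniformly_k_connected_def)
      then show "\<exists>P\<subseteq>paths_between G u v. edge_disjoint_paths P \<and> card P = 3"
        unfolding max_independent_paths_eq_iff using independent_imp_edge_disjoint uv(3) by metis
      show "card P \<le> 3" if "P \<subseteq> paths_between G u v" "edge_disjoint_paths P" for P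
        using uniformly_3_connected_edge_disjoint_le_3[OF unif uv that] .
    qed
  next
    assume *: "k_connected 3 G \<and> uniformly_k_edge_connected 3 G"
    show "uniformly_k_connected 3 G"
      unfolding uniformly_k_connected_def max_independent_paths_eq_iff
    proof (intro conjI ballI impI allI)
      show "3 + 1 \<le> card (verts G)" using * by (simp add: k_connected_def)
      fix u v assume uv: "u \<in> verts G" "v \<in> verts G" "u \<noteq> v"
      \<comment> \<open>3-connectivity bounds all relevant orders below by 3; the upper bound is
        inherited from edge-disjoint paths.\<close>
      show "\<exists>P\<subseteq>paths_between G u v. independent_paths P \<and> card P = 3"
        using uv * by (intro mixed_menger k_connected_imp_sep_order_ge) auto
      show "card P \<le> 3" if "P \<subseteq> paths_between G u v" "independent_paths P" for P
        using * uv that independent_imp_edge_disjoint[OF that(1) uv(3) that(2)]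
        unfolding uniformly_k_edge_connected_def max_edge_disjoint_paths_eq_iff by blast
    qed
  qed
qed

end
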